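(* Let $q$ be a prime power, let $t$ be a positive integer, and let $\mathbb K$ be the algebraic closure of $\mathbb F_q$, regarded as an $\mathbb F_q$-vector space (of countably infinite dimension). For $a\in\mathbb K\setminus\{0\}$ and $B=(b_1,\ldots,b_t)\in\mathbb K^t$ let \[ f_{a,B}(x)=a^q x+b_1x^q+\cdots+b_t x^{q^t}+(-1)^{t+1}a\,x^{q^{t+1}}\in\mathbb K[x], \] let $\ker f_{a,B}$ denote the set of roots of $f_{a,B}$ in $\mathbb K$, let $\mathcal B_a=\{\ker f_{a,B}\mid B\in\mathbb K^t\}$, and let $\mathcal L=\{\mathcal B_a\mid a\in\mathbb K\setminus\{0\}\}$. Then $\mathcal L$ is an $LS(t,t+1,\mathbb K)_q$.
   Context: All vector spaces are $\mathbb F_q$-subspaces of $\mathbb K$. The set of roots in $\mathbb K$ of a linearised polynomial $\sum_i c_i x^{q^i}$ is an $\mathbb F_q$-subspace of $\mathbb K$. For an $\mathbb F_q$-vector space $V$, an $S(t,k,V)_q$ ($q$-Steiner system) is a collection $\mathcal B$ of $k$-dimensional subspaces of $V$ such that every $t$-dimensional subspace of $V$ is contained in exactly one element of $\mathcal B$. An $LS(t,k,V)_q$ (large set of $q$-Steiner systems) is a partition of the set of all $k$-dimensional subspaces of $V$ into $S(t,k,V)_q$ systems; here the partition classes are the distinct sets $\mathcal B_a$ (note that $\mathcal B_a$ and $\mathcal B_{\lambda a}$ may coincide for $\lambda\in\mathbb F_q^*$). *)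

theory Defs
  imports
    "HOL-Algebra.Algebraic_Closure_Type"
    "HOL-Library.Cardinality"
    "HOL-Library.Disjoint_Sets"
    "HOL-Library.FuncSet"
begin

locale subspace_design = vector_space scale
  for scale :: "'f::field \<Rightarrow> 'b::ab_group_add \<Rightarrow> 'b"
begin

text \<open>
  The \<open>k\<close>-dimensional subspaces of \<open>V\<close>. The dimension is given by an explicit finite basis,
  since \<^const>\<open>dim\<close> is \<open>0\<close> on infinite-dimensional spaces.
\<close>
definition subspaces_of_dim :: "nat \<Rightarrow> 'b set \<Rightarrow> 'b set set" where
  "subspaces_of_dim k V =
     {W. subspace W \<and> W \<subseteq> V \<and>
         (\<exists>S. finite S \<and> independent S \<and> span S = W \<and> card S = k)}"

definition q_steiner_system :: "nat \<Rightarrow> nat \<Rightarrow> 'b set \<Rightarrow> 'b set set \<Rightarrow> bool" where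
  "q_steiner_system t k V \<B> \<longleftrightarrow>
     \<B> \<subseteq> subspaces_of_dim k V \<and>
     (\<forall>U \<in> subspaces_of_dim t V. \<exists>!W. W \<in> \<B> \<and> U \<subseteq> W)"

definition large_set :: "nat \<Rightarrow> nat \<Rightarrow> 'b set \<Rightarrow> 'b set set set \<Rightarrow> bool" where
  "large_set t k V \<L> \<longleftrightarrow>
     partition_on (subspaces_of_dim k V) \<L> \<and>
     (\<forall>\<B> \<in> \<L>. q_steiner_system t k V \<B>)"

end

definition ac_scale :: "'a::field \<Rightarrow> 'a alg_closure \<Rightarrow> 'a alg_closure" where
  "ac_scale c x = to_ac c * x"

global_interpretation ac: subspace_design ac_scale
  by unfold_locales (simp_all add: ac_scale_def algebra_simps)

text \<open>
  A tuple in \<open>K\<^sup>t\<close> is an extensional function on \<open>{1..t}\<close>. The prime power \<open>q\<close> is a separate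
  argument, to be instantiated with the order of the ground field.
\<close>
definition lin_poly :: "nat \<Rightarrow> nat \<Rightarrow> 'k::field \<Rightarrow> (nat \<Rightarrow> 'k) \<Rightarrow> 'k poly" where
  "lin_poly q t a B =
     monom (a ^ q) 1 + (\<Sum>i = 1..t. monom (B i) (q ^ i))
       + monom ((-1) ^ (t + 1) * a) (q ^ (t + 1))"

definition root_set :: "'k::field poly \<Rightarrow> 'k set" where
  "root_set f = {x. poly f x = 0}"

definition kernel_class :: "nat \<Rightarrow> nat \<Rightarrow> 'k::field \<Rightarrow> 'k set set" where
  "kernel_class q t a = {root_set (lin_poly q t a B) | B. B \<in> {1..t} \<rightarrow>\<^sub>E UNIV}"

definition kernel_family :: "nat \<Rightarrow> nat \<Rightarrow> 'k::field set set set" where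
  "kernel_family q t = {kernel_class q t a | a. a \<noteq> 0}"

end

theory Submission
  imports Defs
begin

text \<open>
  For a \<open>k\<close>-dimensional subspace \<open>U\<close>, the monic polynomial \<open>P\<^sub>U\<close> with simple roots exactly on \<open>U\<close> is
  linearised; inductively, adding \<open>w\<close> to a basis replaces \<open>P\<close> by \<open>P\<^sup>q - P(w)\<^bsup>q-1\<^esup> P\<close>.
  Since \<open>f\<^bsub>a,B\<^esub>\<close> is separable of degree \<open>q\<^bsup>t+1\<^esup>\<close>, its kernel is \<open>W\<close> iff it is the multiple
  \<open>(-1)\<^bsup>t+1\<^esup> a P\<^sub>W\<close>, i.e. iff \<open>a\<^bsup>q-1\<^esup>\<close> is, up to sign, the linear coefficient of \<open>P\<^sub>W\<close>: this gives
  the partition. For the Steiner property, \<open>P\<^sub>U\<^sup>q - e P\<^sub>U\<close> vanishes on the \<open>t\<close>-dimensional \<open>U\<close> and a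
  suitable \<open>e\<close> adjusts the linear coefficient; two solutions \<open>B, B'\<close> differ by a polynomial in
  \<open>X\<^sup>q\<close> of degree at most \<open>q\<^bsup>t-1\<^esup>\<close> in \<open>X\<^sup>q\<close> that vanishes on the \<open>q\<^sup>t\<close> elements of \<open>U\<close>.
\<close>

section \<open>Counting roots of polynomials and elements of spans\<close>

lemma poly_eq_0_if_many_roots:
  fixes p :: "'k::{comm_ring_1,ring_no_zero_divisors} poly"
  assumes "\<And>x. x \<in> A \<Longrightarrow> poly p x = 0" and "degree p < card A"
  shows "p = 0"
proof (rule ccontr)
  assume "p \<noteq> 0"
  then have "card A \<le> card {x. poly p x = 0}"
    using assms(1) by (intro card_mono) (auto simp: poly_roots_finite)
  with card_poly_roots_bound[OF \<open>p \<noteq> 0\<close>] assms(2) show False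
    by linarith
qed

lemma smult_sum_right: "smult a (\<Sum>i\<in>I. f i) = (\<Sum>i\<in>I. smult a (f i))"
  by (induction I rule: infinite_finite_induct) (simp_all add: smult_add_right)

text \<open>The polynomial splits into linear factors. A factor occurring twice would give a common
  root of \<open>p\<close> and \<open>pderiv p\<close>, so the multiset of roots has no
  repetition.\<close>

lemma card_roots_separable:
  fixes p :: "'k::alg_closed_field poly"
  assumes "p \<noteq> 0" and "\<And>x. poly p x = 0 \<Longrightarrow> poly (pderiv p) x \<noteq> 0"
  shows "card {x. poly p x = 0} = degree p"
proof -
  obtain A where A: "size A = degree p" "p = smult (lead_coeff p) (\<Prod>x\<in>#A. [:-x, 1:])"
    using alg_closed_imp_factorization[OF assms(1)] by blast
  have roots: "{x. poly p x = 0} = set_mset A"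
    using assms(1) by (subst A(2)) (auto simp: poly_prod_mset prod_mset_zero_iff)
  have "count A x = 1" if x: "x \<in># A" for x
  proof (rule ccontr)
    assume "count A x \<noteq> 1"
    with x have "count A x \<ge> 2"
      using count_greater_eq_one_iff[of A x] by linarith
    then have "{#x, x#} \<subseteq># A"
      by (simp add: mset_subset_eq_count subseteq_mset_def)
    then obtain C where C: "A = {#x, x#} + C"
      using mset_subset_eq_exists_conv by blast
    define r where "r = smult (lead_coeff p) (\<Prod>x\<in>#C. [:-x, 1:])"
    define l where "l = [:-x, 1:]"
    have p: "p = l * (l * r)"
      by (subst A(2)) (simp add: C r_def l_def)
    have "poly l x = 0"
      by (simp add: l_def)
    then have "poly (pderiv p) x = 0" "poly p x = 0"
      unfolding p by (simp_all add: pderiv_mult)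
    with assms(2) show False
      by blast
  qed
  then have "size A = card (set_mset A)"
    by (simp add: size_multiset_overloaded_eq)
  with A(1) roots show ?thesis
    by simp
qed

text \<open>A new basis vector \<open>w\<close> multiplies the size by that of the field, since each
  element of the larger span is uniquely a multiple of \<open>w\<close> plus an element of the old
  span.\<close>

lemma (in vector_space) card_span_independent:
  assumes "finite (UNIV :: 'a set)" and "finite S" and "independent S"
  shows "card (span S) = CARD('a) ^ card S \<and> finite (span S)"
  using assms(2,3)
proof (induction S rule: finite_induct)
  case empty
  then show ?case by simp
next
  case (insert w S)
  have w: "w \<notin> span S" and S: "independent S"
    using insert by (auto simp: independent_insert)
  define g where "g = (\<lambda>(k, u). scale k w + u)"
  have "inj_on g (UNIV \<times> span S)"
  proof (rule inj_onI, clarsimp simp: g_def)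
    fix k u k' u'
    assume u: "u \<in> span S" "u' \<in> span S" and eq: "scale k w + u = scale k' w + u'"
    have d: "scale (k - k') w = u' - u"
      using eq by (simp add: scale_left_diff_distrib algebra_simps)
    then have "scale (k - k') w \<in> span S"
      using u by (simp add: span_diff)
    \<comment> \<open>If \<open>k\<close> and \<open>k'\<close> differed, dividing by their
      difference would put \<open>w\<close> into the old span.\<close>
    from span_scale[OF this, of "inverse (k - k')"] have "k = k'"
      using w by (cases "k = k'") auto
    with eq show "k = k' \<and> u = u'" by simp
  qed
  moreover have "span (insert w S) = g ` (UNIV \<times> span S)"
  proof -
    have "x \<in> g ` (UNIV \<times> span S)" if "x - scale k w \<in> span S" for x k
      using that by (intro image_eqI[of _ _ "(k, x - scale k w)"]) (auto simp: g_def)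
    moreover have "\<exists>k. g z - scale k w \<in> span S" if "z \<in> UNIV \<times> span S" for z
      using that by (auto simp: g_def intro!: exI[of _ "fst z"])
    ultimately show ?thesis
      by (auto simp: span_insert)
  qed
  ultimately show ?case
    using insert S assms(1) by (simp add: card_image card_cartesian_product)
qed


section \<open>The additive map x^q on the algebraic closure\<close>

lemma card_range_to_ac: "card (range (to_ac :: 'a::finite_field \<Rightarrow> 'a alg_closure)) = CARD('a)"
  by (simp add: card_image inj_to_ac)

text \<open>Translation by 1 permutes the field, so it preserves the sum of all elements, yet it
  adds q copies of 1 to that sum.\<close>

lemma of_nat_card_finite_field: "of_nat CARD('a) = (0 :: 'a::finite_field)"
proof -
  have "(\<Sum>c\<in>UNIV. c) = (\<Sum>c\<in>UNIV. c + (1::'a))"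
    by (rule sum.reindex_bij_witness[of _ "\<lambda>c. c + 1" "\<lambda>c. c - 1"]) auto
  also have "\<dots> = (\<Sum>c\<in>UNIV. c) + of_nat CARD('a)"
    by (simp add: sum.distrib)
  finally show ?thesis
    by simp
qed

lemma card_finite_field_ge_2: "CARD('a::finite_field) \<ge> 2"
proof -
  have "card {0, 1::'a} \<le> CARD('a)"
    by (intro card_mono) auto
  then show ?thesis
    by simp
qed

lemma power_card_add_if_on_ground_field:
  fixes x y :: "'a::finite_field alg_closure"
  assumes "\<And>c. (to_ac c + y) ^ CARD('a) = to_ac c ^ CARD('a) + y ^ CARD('a)"
  shows "(x + y) ^ CARD('a) = x ^ CARD('a) + y ^ CARD('a)"
proof -
  define q where "q = CARD('a)"
  have q: "q > 0"
    by (simp add: q_def)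
  define h where "h = [:y, 1:] ^ q - monom 1 q - [:y ^ q:]"
  have h_eval: "poly h z = (z + y) ^ q - z ^ q - y ^ q" for z
    by (simp add: h_def poly_monom add.commute)
  have "degree h \<le> q"
    unfolding h_def
    by (intro degree_diff_le) (auto simp: degree_linear_power degree_monom_eq)
  \<comment> \<open>The two monic terms of degree q cancel; only this strict drop in degree makes
    the q elements of the ground field too many roots.\<close>
  moreover have "coeff h q = 0"
    using q by (simp add: h_def coeff_linear_power coeff_pCons split: nat.splits)
  ultimately have "degree h < q"
    using q by (metis degree_0 eq_zero_or_degree_less)
  then have "h = 0"
    using assms
    by (intro poly_eq_0_if_many_roots[of "range to_ac"])
       (auto simp: h_eval card_range_to_ac q_def)
  then show ?thesis
    using h_eval[of x] by (simp add: q_def algebra_simps)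
qed

text \<open>
  The polynomial \<open>(X + y)\<^sup>q - X\<^sup>q - y\<^sup>q\<close> has degree less than \<open>q\<close>, so it vanishes as soon as it
  does so on \<open>\<F>\<^sub>q\<close>: this is clear for \<open>y \<in> \<F>\<^sub>q\<close>, and with the roles of the summands exchanged
  it then holds for all \<open>y\<close>.
\<close>
lemma power_card_add:
  fixes x y :: "'a::finite_field alg_closure"
  shows "(x + y) ^ CARD('a) = x ^ CARD('a) + y ^ CARD('a)"
proof -
  have "(to_ac c + to_ac d) ^ CARD('a) = to_ac c ^ CARD('a) + to_ac d ^ CARD('a)" for c d :: 'a
    by (simp add: finite_field_power_card_eq_same flip: to_ac_add to_ac_power)
  then have "(x + to_ac d) ^ CARD('a) = x ^ CARD('a) + to_ac d ^ CARD('a)" for x and d :: 'a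
    by (rule power_card_add_if_on_ground_field)
  then have "(to_ac d + y) ^ CARD('a) = to_ac d ^ CARD('a) + y ^ CARD('a)" for d :: 'a
    by (simp add: add.commute)
  then show ?thesis
    by (rule power_card_add_if_on_ground_field)
qed

lemma power_card_sum:
  fixes f :: "'b \<Rightarrow> 'a::finite_field alg_closure"
  shows "(\<Sum>i\<in>I. f i) ^ CARD('a) = (\<Sum>i\<in>I. f i ^ CARD('a))"
  by (induction I rule: infinite_finite_induct) (auto simp: power_card_add zero_power)

lemma inj_power_card: "inj (\<lambda>x :: 'a::finite_field alg_closure. x ^ CARD('a))"
proof (rule injI)
  fix x y :: "'a alg_closure"
  assume "x ^ CARD('a) = y ^ CARD('a)"
  then have "(x - y) ^ CARD('a) = 0"
    using power_card_add[of "x - y" y] by simp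
  then show "x = y"
    by simp
qed

lemma power_card_power_add:
  fixes x y :: "'a::finite_field alg_closure"
  shows "(x + y) ^ (CARD('a) ^ i) = x ^ (CARD('a) ^ i) + y ^ (CARD('a) ^ i)"
  by (induction i) (simp_all add: power_card_add power_mult power_Suc2 del: power_Suc)

lemma to_ac_power_card_power: "to_ac (c :: 'a::finite_field) ^ (CARD('a) ^ i) = to_ac c"
  by (simp add: finite_field_power_card_power_eq_same flip: to_ac_power)

subsection \<open>Linearised polynomials\<close>

definition linearised :: "nat \<Rightarrow> nat \<Rightarrow> (nat \<Rightarrow> 'k::field) \<Rightarrow> 'k poly" where
  "linearised q k c = (\<Sum>i\<le>k. monom (c i) (q ^ i))"

lemma poly_linearised: "poly (linearised q k c) x = (\<Sum>i\<le>k. c i * x ^ (q ^ i))"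
  by (simp add: linearised_def poly_sum poly_monom)

lemma degree_linearised_le:
  assumes "q \<ge> 2"
  shows "degree (linearised q k c) \<le> q ^ k"
  unfolding linearised_def
proof (intro degree_sum_le)
  fix i assume "i \<in> {..k}"
  then have "q ^ i \<le> q ^ k"
    using assms by (intro power_increasing) auto
  then show "degree (monom (c i) (q ^ i)) \<le> q ^ k"
    using degree_monom_le le_trans by blast
qed simp

lemma coeff_linearised:
  assumes "q \<ge> 2" and "i \<le> k"
  shows "coeff (linearised q k c) (q ^ i) = c i"
proof -
  have "coeff (linearised q k c) (q ^ i) = (\<Sum>j\<le>k. if j = i then c j else 0)"
    unfolding linearised_def coeff_sum
    using assms by (intro sum.cong) (auto simp: power_inject_exp)
  then show ?thesis
    using assms by simp
qed

lemma linearised_eq_0D: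
  assumes "linearised q k c = 0" and "q \<ge> 2" and "i \<le> k"
  shows "c i = 0"
  using coeff_linearised[OF assms(2,3), of c] assms(1) by simp

lemma subspace_root_set_linearised:
  "ac.subspace (root_set (linearised CARD('a) k c) :: 'a::finite_field alg_closure set)"
proof (rule ac.subspaceI)
  show "0 \<in> (root_set (linearised CARD('a) k c) :: 'a alg_closure set)"
    by (simp add: root_set_def poly_linearised zero_power)
next
  fix x y :: "'a alg_closure"
  assume "x \<in> root_set (linearised CARD('a) k c)" "y \<in> root_set (linearised CARD('a) k c)"
  then show "x + y \<in> root_set (linearised CARD('a) k c)"
    by (simp add: root_set_def poly_linearised power_card_power_add distrib_left sum.distrib)
next
  fix b :: 'a and x :: "'a alg_closure"
  assume x: "x \<in> root_set (linearised CARD('a) k c)"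
  have "poly (linearised CARD('a) k c) (ac_scale b x) = to_ac b * poly (linearised CARD('a) k c) x"
    by (simp add: poly_linearised ac_scale_def power_mult_distrib to_ac_power_card_power
        sum_distrib_left mult_ac)
  with x show "ac_scale b x \<in> root_set (linearised CARD('a) k c)"
    by (simp add: root_set_def)
qed

text \<open>Since q is zero in the field, every term but the linear one has derivative zero. The
  derivative is thus the constant \<open>c 0\<close>, and all roots are simple.\<close>

lemma card_root_set_linearised:
  fixes c :: "nat \<Rightarrow> 'a::finite_field alg_closure"
  assumes "c 0 \<noteq> 0" and "c k \<noteq> 0"
  shows "card (root_set (linearised CARD('a) k c)) = CARD('a) ^ k"
proof -
  define p where "p = linearised CARD('a) k c"
  have coeff: "coeff p (CARD('a) ^ i) = c i" if "i \<le> k" for i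
    unfolding p_def using card_finite_field_ge_2 that by (rule coeff_linearised)
  have "of_nat CARD('a) = (0 :: 'a alg_closure)"
    by (metis of_nat_card_finite_field to_ac_0 to_ac_of_nat)
  then have "pderiv (monom (c i) (CARD('a) ^ i)) = (if i = 0 then [:c 0:] else 0)" for i
    by (cases i) (simp_all add: pderiv_monom monom_0)
  then have "pderiv p = [:c 0:]"
    by (simp add: p_def linearised_def higher_pderiv_sum[of 1, simplified])
  moreover have "p \<noteq> 0"
    using coeff[of k] assms(2) by auto
  ultimately have "card {x. poly p x = 0} = degree p"
    using assms(1) by (intro card_roots_separable) auto
  moreover have "degree p = CARD('a) ^ k"
    using coeff[of k] assms(2) degree_linearised_le[OF card_finite_field_ge_2, of k c]
    by (intro antisym le_degree) (auto simp: p_def)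
  ultimately show ?thesis
    by (simp add: p_def root_set_def)
qed

section \<open>Linearised polynomials with a prescribed root space\<close>

text \<open>The coefficients of \<open>P\<^sup>q - e P\<close> for the linearised polynomial \<open>P\<close> with coefficients \<open>c\<close>.\<close>
definition power_minus_coeffs :: "nat \<Rightarrow> nat \<Rightarrow> 'k::field \<Rightarrow> (nat \<Rightarrow> 'k) \<Rightarrow> nat \<Rightarrow> 'k" where
  "power_minus_coeffs q k e c i =
     (case i of 0 \<Rightarrow> - e * c 0 | Suc j \<Rightarrow> c j ^ q - (if j < k then e * c (Suc j) else 0))"

lemma poly_linearised_power_minus:
  fixes c :: "nat \<Rightarrow> 'a::finite_field alg_closure"
  shows "poly (linearised CARD('a) (Suc k) (power_minus_coeffs CARD('a) k e c)) x
       = poly (linearised CARD('a) k c) x ^ CARD('a) - e * poly (linearised CARD('a) k c) x"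
proof -
  let ?q = "CARD('a)"
  \<comment> \<open>The q-th power shifts indices up by one, so index 0 stems from the subtracted
    multiple alone and index \<open>Suc k\<close> from the power alone.\<close>
  have "(\<Sum>j\<le>k. (if j < k then e * c (Suc j) else 0) * x ^ (?q ^ Suc j))
      = (\<Sum>j<k. e * c (Suc j) * x ^ (?q ^ Suc j))"
    by (intro sum.mono_neutral_cong_right) auto
  moreover have "poly (linearised ?q k c) x ^ ?q = (\<Sum>j\<le>k. c j ^ ?q * x ^ (?q ^ Suc j))"
    by (simp add: poly_linearised power_card_sum power_mult_distrib mult.commute flip: power_mult)
  moreover have "e * poly (linearised ?q k c) x
      = e * c 0 * x + (\<Sum>j<k. e * c (Suc j) * x ^ (?q ^ Suc j))"
    by (simp add: poly_linearised sum.atMost_shift distrib_left sum_distrib_left mult.assoc)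
  moreover have "poly (linearised ?q (Suc k) (power_minus_coeffs ?q k e c)) x
      = - e * c 0 * x + (\<Sum>j\<le>k. c j ^ ?q * x ^ (?q ^ Suc j))
        - (\<Sum>j\<le>k. (if j < k then e * c (Suc j) else 0) * x ^ (?q ^ Suc j))"
    unfolding poly_linearised sum.atMost_Suc_shift
    by (simp add: power_minus_coeffs_def left_diff_distrib sum_subtractf del: power_Suc)
  ultimately show ?thesis
    by simp
qed

lemma linearised_vanishing_exactly_on_span:
  fixes S :: "'a::finite_field alg_closure set"
  assumes "finite S" and "ac.independent S"
  shows "\<exists>c. c (card S) = 1 \<and> c 0 \<noteq> 0 \<and> root_set (linearised CARD('a) (card S) c) = ac.span S"
  using assms
proof (induction S rule: finite_induct)
  case empty
  \<comment> \<open>The zero space belongs to the polynomial X.\<close>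
  show ?case
    by (intro exI[of _ "\<lambda>_. 1"]) (auto simp: root_set_def poly_linearised)
next
  case (insert w S)
  let ?q = "CARD('a)" and ?k = "card S"
  have w: "w \<notin> ac.span S" and S: "ac.independent S"
    using insert by (auto simp: ac.independent_insert)
  from insert.IH[OF S] obtain c where c: "c ?k = 1" "c 0 \<noteq> 0"
    and roots: "root_set (linearised ?q ?k c) = ac.span S"
    by blast
  define P where "P = poly (linearised ?q ?k c)"
  \<comment> \<open>This makes \<open>w\<close> a root of the new polynomial. As \<open>e\<close> is
    nonzero, the linear coefficient stays nonzero, which keeps the roots countable.\<close>
  define e where "e = P w ^ (?q - 1)"
  define c' where "c' = power_minus_coeffs ?q ?k e c"
  have P': "poly (linearised ?q (Suc ?k) c') x = P x ^ ?q - e * P x" for x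
    unfolding c'_def P_def by (rule poly_linearised_power_minus)
  have Pw: "P w \<noteq> 0"
    using w roots by (auto simp: P_def root_set_def)
  then have "e \<noteq> 0"
    by (simp add: e_def)
  with c have c': "c' (Suc ?k) = 1" "c' 0 \<noteq> 0"
    by (auto simp: c'_def power_minus_coeffs_def)
  have "P w ^ ?q - e * P w = 0"
    by (simp add: e_def flip: power_Suc2)
  then have "w \<in> root_set (linearised ?q (Suc ?k) c')"
    by (simp add: root_set_def P')
  moreover have "P x = 0" if "x \<in> S" for x
    using that roots ac.span_base[OF that] by (auto simp: P_def root_set_def)
  then have "S \<subseteq> root_set (linearised ?q (Suc ?k) c')"
    by (auto simp: root_set_def P' zero_power)
  ultimately have "ac.span (insert w S) \<subseteq> root_set (linearised ?q (Suc ?k) c')"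
    by (intro ac.span_minimal subspace_root_set_linearised) auto
  \<comment> \<open>The inclusion becomes an equality because both finite sets have the same
    size.\<close>
  moreover have "card (ac.span (insert w S)) = card (root_set (linearised ?q (Suc ?k) c'))"
    using ac.card_span_independent[of "insert w S"] insert c'
    by (simp add: card_root_set_linearised)
  moreover have "finite (root_set (linearised ?q (Suc ?k) c'))"
    using card_root_set_linearised[of c' "Suc ?k"] c' by (intro card_ge_0_finite) simp
  ultimately have "root_set (linearised ?q (Suc ?k) c') = ac.span (insert w S)"
    by (metis card_subset_eq)
  with c' insert show ?case
    by auto
qed

text \<open>Over a finite field size determines dimension, so statements about dimensions of kernels
  reduce to counting roots.\<close>

lemma subspaces_of_dim_iff_card:
  fixes W :: "'a::finite_field alg_closure set"
  shows "W \<in> ac.subspaces_of_dim k UNIV \<longleftrightarrow> ac.subspace W \<and> card W = CARD('a) ^ k"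
proof
  assume "W \<in> ac.subspaces_of_dim k UNIV"
  then obtain S where "ac.subspace W" "finite S" "ac.independent S" "ac.span S = W" "card S = k"
    by (auto simp: ac.subspaces_of_dim_def)
  then show "ac.subspace W \<and> card W = CARD('a) ^ k"
    using ac.card_span_independent[of S] by auto
next
  assume W: "ac.subspace W \<and> card W = CARD('a) ^ k"
  then have "finite W"
    by (intro card_ge_0_finite) simp
  obtain S where S: "S \<subseteq> W" "ac.independent S" "W \<subseteq> ac.span S"
    by (rule ac.basis_exists)
  then have "finite S" "ac.span S = W"
    using \<open>finite W\<close> W finite_subset[of S W] ac.span_subspace[of S W] by simp_all
  moreover have "card S = k"
    using ac.card_span_independent[of S] S W calculation card_finite_field_ge_2[where 'a = 'a]
    by (auto simp: power_inject_exp)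
  ultimately show "W \<in> ac.subspaces_of_dim k UNIV"
    using S(2) W by (auto simp: ac.subspaces_of_dim_def)
qed

subsection \<open>The polynomials \<open>f\<^bsub>a,B\<^esub>\<close>\<close>

lemma lin_poly_eq_linearised:
  "lin_poly q t a B = linearised q (t + 1)
     (\<lambda>i. if i = 0 then a ^ q else if i = t + 1 then (-1) ^ (t + 1) * a else B i)"
proof -
  have "{..t} = insert 0 {1..t}"
    by auto
  moreover have "(\<Sum>i = 1..t. monom (B i) (q ^ i))
      = (\<Sum>i = 1..t. monom (if i = 0 then a ^ q else if i = t + 1 then (-1) ^ (t + 1) * a else B i) (q ^ i))"
    by (intro sum.cong) auto
  ultimately show ?thesis
    by (simp add: lin_poly_def linearised_def)
qed

lemma root_set_lin_poly_in_subspaces_of_dim: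
  fixes a :: "'a::finite_field alg_closure"
  assumes "a \<noteq> 0"
  shows "root_set (lin_poly CARD('a) t a B) \<in> ac.subspaces_of_dim (t + 1) UNIV"
  using assms
  by (simp only: subspaces_of_dim_iff_card lin_poly_eq_linearised subspace_root_set_linearised)
     (subst card_root_set_linearised; simp)

text \<open>Scaling by \<open>(-1) ^ (t + 1) * a\<close> gives the required leading coefficient. In
  the linear coefficient the two signs cancel and \<open>a ^ q\<close> remains; the middle
  coefficients are free and supply \<open>B\<close>.\<close>

lemma kernel_class_memI:
  fixes a :: "'a::finite_field alg_closure"
  assumes "a \<noteq> 0" and "c (t + 1) = 1" and "c 0 = (-1) ^ (t + 1) * a ^ (CARD('a) - 1)"
  shows "root_set (linearised CARD('a) (t + 1) c) \<in> kernel_class CARD('a) t a"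
proof -
  let ?q = "CARD('a)"
  define s where "s = (-1) ^ (t + 1) * a"
  define B where "B = (\<lambda>i\<in>{1..t}. s * c i)"
  have "s * c 0 = ((-1) ^ (t + 1) * (-1) ^ (t + 1)) * (a ^ (?q - 1) * a)"
    unfolding s_def assms(3) by (simp only: mult_ac)
  also have "\<dots> = a ^ ?q"
    by (simp add: power_Suc2[symmetric] flip: power_mult_distrib)
  finally have "(if i = 0 then a ^ ?q else if i = t + 1 then (-1) ^ (t + 1) * a else B i) = s * c i"
    if "i \<le> t + 1" for i
    using that assms(2) by (auto simp: B_def s_def)
  then have "lin_poly ?q t a B = linearised ?q (t + 1) (\<lambda>i. s * c i)"
    unfolding lin_poly_eq_linearised linearised_def by (intro sum.cong) auto
  then have "poly (lin_poly ?q t a B) x = s * poly (linearised ?q (t + 1) c) x" for x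
    by (simp only: poly_linearised mult.assoc sum_distrib_left)
  moreover have "s \<noteq> 0"
    using assms(1) by (simp add: s_def)
  ultimately have "root_set (lin_poly ?q t a B) = root_set (linearised ?q (t + 1) c)"
    by (simp add: root_set_def)
  moreover have "B \<in> {1..t} \<rightarrow>\<^sub>E UNIV"
    by (simp add: B_def)
  ultimately show ?thesis
    unfolding kernel_class_def by blast
qed

text \<open>The outer coefficients agree, so the difference has degree at most q^t, one short of a
  contradiction with q^t roots. Writing it as \<open>g\<close> at x^q lowers the degree, while
  injectivity of the q-th power preserves the number of roots.\<close>

lemma lin_poly_eq_if_vanish_on:
  fixes a :: "'a::finite_field alg_closure"
  assumes "t \<ge> 1" and "card U = CARD('a) ^ t"
    and "U \<subseteq> root_set (lin_poly CARD('a) t a B)" and "U \<subseteq> root_set (lin_poly CARD('a) t a B')"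
  shows "lin_poly CARD('a) t a B = lin_poly CARD('a) t a B'"
proof -
  let ?q = "CARD('a)"
  define g where "g = linearised ?q (t - 1) (\<lambda>i. B (Suc i) - B' (Suc i))"
  have "poly g (x ^ ?q) = poly (lin_poly ?q t a B) x - poly (lin_poly ?q t a B') x" for x
  proof -
    have "poly g (x ^ ?q) = (\<Sum>i\<in>{..t-1}. (B (Suc i) - B' (Suc i)) * x ^ (?q ^ Suc i))"
      by (simp add: g_def poly_linearised flip: power_mult)
    also have "\<dots> = (\<Sum>i=1..t. (B i - B' i) * x ^ (?q ^ i))"
      using assms(1) by (intro sum.reindex_bij_witness[of _ "\<lambda>i. i - 1" Suc]) auto
    finally show ?thesis
      by (simp add: lin_poly_def poly_sum poly_monom left_diff_distrib sum_subtractf)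
  qed
  then have "poly g (x ^ ?q) = 0" if "x \<in> U" for x
    using subsetD[OF assms(3) that] subsetD[OF assms(4) that] by (simp add: root_set_def)
  then have "poly g y = 0" if "y \<in> (\<lambda>x. x ^ ?q) ` U" for y
    using that by auto
  moreover have "card ((\<lambda>x. x ^ ?q) ` U) = ?q ^ t"
    using assms(2) inj_power_card by (metis card_image inj_on_subset top_greatest)
  moreover have "degree g < ?q ^ t"
  proof -
    have "degree g \<le> ?q ^ (t - 1)"
      unfolding g_def by (rule degree_linearised_le[OF card_finite_field_ge_2])
    also have "\<dots> < ?q ^ t"
      using assms(1) card_finite_field_ge_2[where 'a = 'a] by (intro power_strict_increasing) auto
    finally show ?thesis .
  qed
  ultimately have "g = 0"
    using poly_eq_0_if_many_roots by metis
  then have "B i = B' i" if "i \<in> {1..t}" for i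
    using linearised_eq_0D[of ?q "t - 1" "\<lambda>i. B (Suc i) - B' (Suc i)" "i - 1"]
      card_finite_field_ge_2[where 'a = 'a] that by (auto simp: g_def)
  then show ?thesis
    by (simp add: lin_poly_def)
qed

section \<open>The Steiner property of a single class\<close>

lemma q_steiner_system_kernel_class:
  fixes a :: "'a::finite_field alg_closure"
  assumes "t \<ge> 1" and "a \<noteq> 0"
  shows "ac.q_steiner_system t (t + 1) UNIV (kernel_class CARD('a) t a)"
  unfolding ac.q_steiner_system_def
proof (intro conjI ballI)
  let ?q = "CARD('a)"
  show "kernel_class ?q t a \<subseteq> ac.subspaces_of_dim (t + 1) UNIV"
    using root_set_lin_poly_in_subspaces_of_dim[OF assms(2)] by (auto simp: kernel_class_def)
  fix U :: "'a alg_closure set"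
  assume U: "U \<in> ac.subspaces_of_dim t UNIV"
  then obtain S where S: "finite S" "ac.independent S" "ac.span S = U" "card S = t"
    by (auto simp: ac.subspaces_of_dim_def)
  then obtain c where c: "c t = 1" "c 0 \<noteq> 0" "root_set (linearised ?q t c) = U"
    using linearised_vanishing_exactly_on_span by blast
  \<comment> \<open>Solves \<open>- e * c 0 = (-1) ^ (t + 1) * a ^ (q - 1)\<close>, the condition
    for membership in the class of \<open>a\<close>.\<close>
  define e where "e = (-1) ^ t * a ^ (?q - 1) / c 0"
  define c' where "c' = power_minus_coeffs ?q t e c"
  have "root_set (linearised ?q (t + 1) c') \<in> kernel_class ?q t a"
    using assms(2) c by (intro kernel_class_memI) (auto simp: c'_def e_def power_minus_coeffs_def)
  moreover have "U \<subseteq> root_set (linearised ?q (t + 1) c')"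
    using poly_linearised_power_minus[of t e c, folded c'_def] c(3)
    by (auto simp: root_set_def zero_power)
  moreover have "W = W'"
    if "W \<in> kernel_class ?q t a" "U \<subseteq> W" "W' \<in> kernel_class ?q t a" "U \<subseteq> W'" for W W'
  proof -
    obtain B B' where "W = root_set (lin_poly ?q t a B)" "W' = root_set (lin_poly ?q t a B')"
      using \<open>W \<in> kernel_class ?q t a\<close> \<open>W' \<in> kernel_class ?q t a\<close>
      by (auto simp: kernel_class_def)
    moreover have "card U = ?q ^ t"
      using U by (simp add: subspaces_of_dim_iff_card)
    ultimately show ?thesis
      using lin_poly_eq_if_vanish_on[OF assms(1)] \<open>U \<subseteq> W\<close> \<open>U \<subseteq> W'\<close> by metis
  qed
  ultimately show "\<exists>!W. W \<in> kernel_class ?q t a \<and> U \<subseteq> W"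
    by blast
qed

section \<open>Disjointness and covering of the classes\<close>

lemma kernel_class_subset_if_proportional:
  fixes a b :: "'k::field"
  assumes "a \<noteq> 0" "b \<noteq> 0" and "b * a ^ q = a * b ^ q"
  shows "kernel_class q t a \<subseteq> kernel_class q t b"
proof
  fix W assume "W \<in> kernel_class q t a"
  then obtain B where B: "W = root_set (lin_poly q t a B)"
    by (auto simp: kernel_class_def)
  \<comment> \<open>The factor \<open>b / a\<close> turns the coefficient \<open>a\<close> into
    \<open>b\<close>; by the third assumption it also turns \<open>a ^ q\<close> into
    \<open>b ^ q\<close>.\<close>
  define B' where "B' = (\<lambda>i\<in>{1..t}. b / a * B i)"
  have "lin_poly q t b B' = smult (b / a) (lin_poly q t a B)"
    using assms
    by (simp add: lin_poly_def B'_def smult_add_right smult_sum_right smult_monom field_simps)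
  then have "root_set (lin_poly q t b B') = W"
    using assms by (simp add: B root_set_def)
  then show "W \<in> kernel_class q t b"
    unfolding kernel_class_def by (auto simp: B'_def intro!: exI[of _ B'])
qed

lemma kernel_class_eq_if_meet:
  fixes a b :: "'a::finite_field alg_closure"
  assumes "a \<noteq> 0" "b \<noteq> 0" and "W \<in> kernel_class CARD('a) t a" "W \<in> kernel_class CARD('a) t b"
  shows "kernel_class CARD('a) t a = kernel_class CARD('a) t b"
proof -
  let ?q = "CARD('a)"
  obtain B B' where W: "W = root_set (lin_poly ?q t a B)" "W = root_set (lin_poly ?q t b B')"
    using assms(3,4) by (auto simp: kernel_class_def)
  \<comment> \<open>Coefficients of the cross-multiplied difference. Its terms of degree q^(t+1)
    cancel, so the roots in \<open>W\<close> force it to vanish, and index 0 gives the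
    proportionality.\<close>
  define c where "c = (\<lambda>i. if i = 0 then b * a ^ ?q - a * b ^ ?q else b * B i - a * B' i)"
  have "linearised ?q t c = smult b (lin_poly ?q t a B) - smult a (lin_poly ?q t b B')"
  proof -
    have "{..t} = insert 0 {1..t}"
      by auto
    moreover have "(\<Sum>i=1..t. monom (c i) (?q ^ i))
        = (\<Sum>i=1..t. monom (b * B i) (?q ^ i)) - (\<Sum>i=1..t. monom (a * B' i) (?q ^ i))"
      unfolding sum_subtractf[symmetric] by (intro sum.cong) (auto simp: c_def diff_monom)
    ultimately show ?thesis
      by (simp add: linearised_def lin_poly_def c_def smult_add_right smult_sum_right smult_monom
          diff_monom[symmetric] mult_ac)
  qed
  then have "poly (linearised ?q t c) x = 0" if "x \<in> W" for x
    using W that by (auto simp: root_set_def)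
  moreover have "card W = ?q ^ (t + 1)"
    using root_set_lin_poly_in_subspaces_of_dim[OF assms(1), of t B] W
    by (simp add: subspaces_of_dim_iff_card)
  moreover have "degree (linearised ?q t c) < ?q ^ (t + 1)"
  proof -
    have "degree (linearised ?q t c) \<le> ?q ^ t"
      by (rule degree_linearised_le[OF card_finite_field_ge_2])
    also have "\<dots> < ?q ^ (t + 1)"
      using card_finite_field_ge_2[where 'a = 'a] by (intro power_strict_increasing) auto
    finally show ?thesis .
  qed
  ultimately have "linearised ?q t c = 0"
    using poly_eq_0_if_many_roots by metis
  then have "c 0 = 0"
    by (rule linearised_eq_0D[OF _ card_finite_field_ge_2]) simp
  then have "b * a ^ ?q = a * b ^ ?q"
    by (simp add: c_def)
  then show ?thesis
    using assms(1,2) by (intro antisym kernel_class_subset_if_proportional) auto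
qed

lemma kernel_classes_cover:
  fixes W :: "'a::finite_field alg_closure set"
  assumes "W \<in> ac.subspaces_of_dim (t + 1) UNIV"
  shows "\<exists>a. a \<noteq> 0 \<and> W \<in> kernel_class CARD('a) t a"
proof -
  let ?q = "CARD('a)"
  obtain S where "finite S" "ac.independent S" "ac.span S = W" "card S = t + 1"
    using assms by (auto simp: ac.subspaces_of_dim_def)
  then obtain c where c: "c (t + 1) = 1" "c 0 \<noteq> 0" "root_set (linearised ?q (t + 1) c) = W"
    using linearised_vanishing_exactly_on_span by metis
  have q: "?q - 1 > 0"
    using card_finite_field_ge_2[where 'a = 'a] by simp
  \<comment> \<open>Algebraic closedness provides the root; the sign is chosen to fit the linear
    coefficient.\<close>
  then obtain a where a: "a ^ (?q - 1) = (-1) ^ (t + 1) * c 0"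
    using nth_root_exists by blast
  have "a \<noteq> 0"
    using a c(2) q by (auto simp: zero_power)
  moreover have "c 0 = (-1) ^ (t + 1) * a ^ (?q - 1)"
    unfolding a by (simp flip: power_mult_distrib mult.assoc)
  ultimately show ?thesis
    using kernel_class_memI[of a c t] c by auto
qed

theorem theorem1p1:
  fixes q t :: nat
  assumes "q = CARD('a::finite_field)"
    and "t \<ge> 1"
  shows "ac.large_set t (t + 1) (UNIV :: 'a alg_closure set) (kernel_family q t)"
  unfolding ac.large_set_def
proof (intro conjI ballI partition_onI)
  show "\<Union> (kernel_family q t) = ac.subspaces_of_dim (t + 1) (UNIV :: 'a alg_closure set)"
  proof (rule antisym)
    show "\<Union> (kernel_family q t) \<subseteq> ac.subspaces_of_dim (t + 1) (UNIV :: 'a alg_closure set)"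
      using root_set_lin_poly_in_subspaces_of_dim[where 'a = 'a]
      by (auto simp: kernel_family_def kernel_class_def assms(1))
    show "ac.subspaces_of_dim (t + 1) (UNIV :: 'a alg_closure set) \<subseteq> \<Union> (kernel_family q t)"
      using kernel_classes_cover[where 'a = 'a] unfolding kernel_family_def assms(1) by blast
  qed
  show "disjnt \<B> \<B>'"
    if "\<B> \<in> kernel_family q t" "\<B>' \<in> kernel_family q t" "\<B> \<noteq> \<B>'"
    for \<B> \<B>' :: "'a alg_closure set set"
    using that kernel_class_eq_if_meet[where 'a = 'a]
    unfolding kernel_family_def assms(1) disjnt_iff by blast
  show "{} \<notin> (kernel_family q t :: 'a alg_closure set set set)"
    by (auto simp: kernel_family_def kernel_class_def PiE_eq_empty_iff)
  show "ac.q_steiner_system t (t + 1) UNIV \<B>"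
    if "\<B> \<in> kernel_family q t" for \<B> :: "'a alg_closure set set"
    using that q_steiner_system_kernel_class[OF assms(2)]
    by (auto simp: kernel_family_def assms(1))
qed

end
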